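(* Let $n$ be a positive integer, and let $x$ and $y$ be nonnegative integers. Then $$\det_{1\le i,j\le n}\left(\binom {x+y+j}{x-i+2j}-\binom {x+y+j}{x+i+2j}\right) =\prod _{j=1} ^{n}\frac {(j-1)!\,(x+y+2j)!\,(x-y+2j+1)_j\,(x+2y+3j+1)_{n-j}} {(x+n+2j)!\,(y+n-j)!}.$$
   Context: The shifted factorial is defined by $(a)_k:=a(a+1)\cdots(a+k-1)$ for $k\ge1$ and $(a)_0:=1$. Binomial coefficients $\binom{m}{k}$ with integer $k$ outside $0\le k\le m$ are zero. *)

theory Defs
  imports "Jordan_Normal_Form.Determinant"
begin

text \<open>The lower index may be a negative integer. For \<open>k > m\<close> the library's \<open>choose\<close> is already zero.\<close>

definition binom_int :: "nat \<Rightarrow> int \<Rightarrow> nat" where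
  "binom_int m k = (if k < 0 then 0 else m choose nat k)"

text \<open>\<open>det\<^sub>1 n a\<close> is the determinant of the matrix with entries \<open>a i j\<close> for \<open>1 \<le> i, j \<le> n\<close>;
  the entries of \<open>mat n n\<close> are indexed from zero.\<close>

definition det\<^sub>1 :: "nat \<Rightarrow> (nat \<Rightarrow> nat \<Rightarrow> 'a :: comm_ring_1) \<Rightarrow> 'a" where
  "det\<^sub>1 n a = det (mat n n (\<lambda>(i, j). a (Suc i) (Suc j)))"

end

theory Submission
  imports "HOL-Analysis.Gamma_Function" "Jordan_Normal_Form.Char_Poly" Defs
begin

text \<open>
  Unitriangular row operations replace the \<open>(i, j)\<close> entry by
  \<open>(x - y + 3j) (x + y + 2i + j - 1)! / ((x + i + 2j)! (y + i - j)!)\<close>, where \<open>1/k! = 0\<close> for \<open>k < 0\<close>.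
  Without the column factor \<open>x - y + 3j\<close>, shifting a row or column index amounts to shifting \<open>(x, y)\<close>, so
  the Desnanot--Jacobi identity gives a recurrence in \<open>n\<close> for the determinant. The product satisfies the
  same recurrence, but it may vanish at integers, where one cannot divide by it. So \<open>y\<close> is made
  real by means of the Gamma function: if \<open>2y\<close> is not an integer, the product is nonzero and
  induction on \<open>n\<close> applies; integral \<open>y\<close> follow by continuity.
\<close>

subsection \<open>The Desnanot--Jacobi identity\<close>

lemma det_two: "A \<in> carrier_mat 2 2 \<Longrightarrow> det A = A $$ (0,0) * A $$ (1,1) - A $$ (0,1) * A $$ (1,0)"
  for A :: "'a :: comm_ring_1 mat"
  apply (subst laplace_expansion_column[of A 2 0])
  apply (auto simp: numeral_2_eq_2 cofactor_def)
  apply (subst det_single, simp add: mat_delete_def)+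
  apply (simp add: mat_delete_def)
  done

text \<open>Expanding along column 1, a unit vector, deletes row and column 1 and leaves a smaller
  matrix of the same shape. In the end only the four corners remain.\<close>

lemma det_outer_columns:
  fixes B :: "'a :: comm_ring_1 mat"
  assumes "B \<in> carrier_mat (n + 2) (n + 2)"
    and "\<And>i j. \<lbrakk>i < n + 2; 0 < j; j \<le> n\<rbrakk> \<Longrightarrow> B $$ (i, j) = (if i = j then 1 else 0)"
  shows "det B = B $$ (0, 0) * B $$ (n + 1, n + 1) - B $$ (0, n + 1) * B $$ (n + 1, 0)"
  using assms
proof (induction n arbitrary: B)
  case 0
  then show ?case using det_two[of B] by (simp add: numeral_2_eq_2)
next
  case (Suc n)
  let ?C = "mat_delete B 1 1"
  have "det B = (\<Sum>i<Suc n + 2. B $$ (i, 1) * cofactor B i 1)"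
    by (rule laplace_expansion_column[OF Suc.prems(1)]) simp
  also have "\<dots> = (\<Sum>i<Suc n + 2. if i = 1 then cofactor B 1 1 else 0)"
    by (rule sum.cong) (use Suc.prems(2)[of _ 1] in auto)
  also have "\<dots> = det ?C"
    by (subst sum.delta) (auto simp: cofactor_def)
  also have "\<dots> = ?C $$ (0, 0) * ?C $$ (n + 1, n + 1) - ?C $$ (0, n + 1) * ?C $$ (n + 1, 0)"
    by (rule Suc.IH) (use Suc.prems in \<open>auto simp: mat_delete_def\<close>)
  finally show ?case
    using Suc.prems(1) by (auto simp: mat_delete_def)
qed

text \<open>Multiply \<open>A\<close> by the identity matrix whose two outer columns are replaced by those of the
  adjugate, and compare determinants.\<close>

lemma Desnanot_Jacobi_nonsingular:
  fixes A :: "'a :: idom mat"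
  assumes A: "A \<in> carrier_mat (n + 2) (n + 2)" and nz: "det A \<noteq> 0"
  shows "det A * det (mat_delete (mat_delete A 0 0) n n)
    = det (mat_delete A (n + 1) (n + 1)) * det (mat_delete A 0 0)
      - det (mat_delete A 0 (n + 1)) * det (mat_delete A (n + 1) 0)"
proof -
  let ?m = "n + 2"
  define B where "B = mat ?m ?m (\<lambda>(i, j). if j = 0 \<or> j = n + 1 then adj_mat A $$ (i, j) else of_bool (i = j))"
  have B: "B \<in> carrier_mat ?m ?m" by (simp add: B_def)
  have adj: "adj_mat A \<in> carrier_mat ?m ?m" using adj_mat(1)[OF A] .
  \<comment> \<open>Since \<open>A * adj_mat A\<close> is \<open>det A\<close> times the identity,
    the outer columns of \<open>A * B\<close> are \<open>det A\<close> times unit vectors; the inner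
    columns are those of \<open>A\<close>.\<close>
  have AB_adj: "(A * B) $$ (i, j) = (if i = j then det A else 0)"
    if "i < ?m" "j = 0 \<or> j = n + 1" for i j
  proof -
    have j: "j < ?m" using that by auto
    have "col B j = col (adj_mat A) j"
      using that adj by (intro eq_vecI) (auto simp: B_def)
    hence "(A * B) $$ (i, j) = (A * adj_mat A) $$ (i, j)"
      using that j A B adj by simp
    also have "\<dots> = (if i = j then det A else 0)"
      using that j by (simp add: adj_mat(2)[OF A])
    finally show ?thesis .
  qed
  have AB_id: "(A * B) $$ (i, j) = A $$ (i, j)" if "i < ?m" "0 < j" "j \<le> n" for i j
  proof -
    have "col B j = unit_vec ?m j"
      using that by (intro eq_vecI) (auto simp: B_def unit_vec_def)
    thus ?thesis using that A B by simp
  qed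
  have AB: "A * B \<in> carrier_mat ?m ?m" using A B by simp
  let ?C = "mat_delete (A * B) 0 0"
  have C: "?C \<in> carrier_mat (n + 1) (n + 1)"
    using mat_delete_carrier[OF AB, of 0 0] by simp
  \<comment> \<open>Expanding along the first and then the last column extracts \<open>det A\<close>
    twice and leaves the interior minor of \<open>A\<close>. One factor \<open>det A\<close> then
    cancels.\<close>
  have "det A * det B = det (A * B)" using det_mult[OF A B] by simp
  also have "\<dots> = (\<Sum>i<?m. (A * B) $$ (i, 0) * cofactor (A * B) i 0)"
    by (rule laplace_expansion_column[OF AB]) simp
  also have "\<dots> = (\<Sum>i<?m. if i = 0 then det A * cofactor (A * B) 0 0 else 0)"
    by (rule sum.cong) (auto simp: AB_adj)
  also have "\<dots> = det A * det ?C" by (subst sum.delta) (auto simp: cofactor_def)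
  also have "det ?C = (\<Sum>i<n + 1. ?C $$ (i, n) * cofactor ?C i n)"
    by (rule laplace_expansion_column[OF C]) simp
  also have "\<dots> = (\<Sum>i<n + 1. if i = n then det A * cofactor ?C n n else 0)"
    by (rule sum.cong) (use AB_adj[of "Suc _" "n + 1"] A B in \<open>auto simp: mat_delete_def\<close>)
  also have "\<dots> = det A * det (mat_delete ?C n n)"
    by (subst sum.delta) (auto simp: cofactor_def)
  also have "mat_delete ?C n n = mat_delete (mat_delete A 0 0) n n"
    using A B AB_id by (intro eq_matI) (auto simp: mat_delete_def)
  finally have *: "det B = det A * det (mat_delete (mat_delete A 0 0) n n)"
    using nz by simp
  have "det B = B $$ (0, 0) * B $$ (n + 1, n + 1) - B $$ (0, n + 1) * B $$ (n + 1, 0)"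
    by (rule det_outer_columns[OF B]) (auto simp: B_def)
  \<comment> \<open>The adjugate is the transposed cofactor matrix, hence the swapped indices. The
    two off-diagonal signs \<open>(-1)^(n + 1)\<close> multiply to 1.\<close>
  also have "\<dots> = cofactor A 0 0 * cofactor A (n + 1) (n + 1) - cofactor A (n + 1) 0 * cofactor A 0 (n + 1)"
    using A by (simp add: B_def adj_mat_def)
  also have "\<dots> = det (mat_delete A (n + 1) (n + 1)) * det (mat_delete A 0 0)
      - det (mat_delete A 0 (n + 1)) * det (mat_delete A (n + 1) 0)"
    by (simp add: cofactor_def flip: power_add mult_2)
  finally show ?thesis using * by simp
qed

lemma Desnanot_Jacobi:
  fixes A :: "'a :: idom mat"
  assumes A: "A \<in> carrier_mat (n + 2) (n + 2)"
  shows "det A * det (mat_delete (mat_delete A 0 0) n n)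
    = det (mat_delete A (n + 1) (n + 1)) * det (mat_delete A 0 0)
      - det (mat_delete A 0 (n + 1)) * det (mat_delete A (n + 1) 0)"
proof -
  \<comment> \<open>\<open>P = X + A\<close> is nonsingular over the polynomial ring; evaluate its identity at \<open>X = 0\<close>.\<close>
  define P where "P = char_poly_matrix (- A)"
  have P: "P \<in> carrier_mat (n + 2) (n + 2)" using A by (simp add: P_def)
  have ev_det: "poly (det M) 0 = det (map_mat (\<lambda>p. poly p 0) M)" for M :: "'a poly mat"
    by (rule comm_ring_hom.hom_det[symmetric]) (unfold_locales, auto)
  have ev: "map_mat (\<lambda>p. poly p 0) P = A"
    using A by (intro eq_matI) (auto simp: P_def char_poly_matrix_def)
  have ev_del: "map_mat (\<lambda>p. poly p 0) (mat_delete M i j) = mat_delete (map_mat (\<lambda>p. poly p 0) M) i j"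
    for M :: "'a poly mat" and i j by (intro eq_matI) (auto simp: mat_delete_def)
  \<comment> \<open>\<open>det P\<close> is the characteristic polynomial of \<open>- A\<close>,
    which is monic.\<close>
  have "det P \<noteq> 0"
    using degree_monic_char_poly[of "- A" "n + 2"] A by (auto simp: P_def char_poly_def)
  from arg_cong[OF Desnanot_Jacobi_nonsingular[OF P this], of "\<lambda>p. poly p 0"]
  show ?thesis
    by (simp add: ev_det ev_del ev)
qed

text \<open>Deleting the first row or column raises an index by one, and deleting the last only
  lowers the size, so every minor is again a \<open>det\<^sub>1\<close> of a shifted
  \<open>a\<close>.\<close>

lemma det\<^sub>1_Desnanot_Jacobi:
  fixes a :: "nat \<Rightarrow> nat \<Rightarrow> 'a :: idom"
  shows "det\<^sub>1 (n + 2) a * det\<^sub>1 n (\<lambda>i j. a (i + 1) (j + 1))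
    = det\<^sub>1 (n + 1) a * det\<^sub>1 (n + 1) (\<lambda>i j. a (i + 1) (j + 1))
      - det\<^sub>1 (n + 1) (\<lambda>i j. a (i + 1) j) * det\<^sub>1 (n + 1) (\<lambda>i j. a i (j + 1))"
proof -
  define A where "A = mat (n + 2) (n + 2) (\<lambda>(i, j). a (Suc i) (Suc j))"
  have A: "A \<in> carrier_mat (n + 2) (n + 2)" by (simp add: A_def)
  have "mat_delete (mat_delete A 0 0) n n = mat n n (\<lambda>(i, j). a (Suc (Suc i)) (Suc (Suc j)))"
    "mat_delete A (n + 1) (n + 1) = mat (n + 1) (n + 1) (\<lambda>(i, j). a (Suc i) (Suc j))"
    "mat_delete A 0 0 = mat (n + 1) (n + 1) (\<lambda>(i, j). a (Suc (Suc i)) (Suc (Suc j)))"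
    "mat_delete A 0 (n + 1) = mat (n + 1) (n + 1) (\<lambda>(i, j). a (Suc (Suc i)) (Suc j))"
    "mat_delete A (n + 1) 0 = mat (n + 1) (n + 1) (\<lambda>(i, j). a (Suc i) (Suc (Suc j)))"
    by (auto intro!: eq_matI simp: A_def mat_delete_def)
  with Desnanot_Jacobi[OF A] show ?thesis
    by (simp add: det\<^sub>1_def A_def)
qed

subsection \<open>The closed form and its recurrence\<close>

text \<open>Extends the product of \<open>(u + 2j)!\<close> to real \<open>u\<close>. It serves with
  \<open>u = x + y\<close> in the numerator and \<open>u = x + n\<close> in the denominator.\<close>

definition gamma_prod :: "nat \<Rightarrow> real \<Rightarrow> real" where
  "gamma_prod m u = (\<Prod>j = 1..m. Gamma (u + 2 * real j + 1))"

text \<open>The product of \<open>(y + m - j)!\<close> in reversed order, \<open>i = m - j\<close>,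
  so that raising \<open>m\<close> only appends a factor.\<close>

definition gamma_prod1 :: "nat \<Rightarrow> real \<Rightarrow> real" where
  "gamma_prod1 m y = (\<Prod>i<m. Gamma (y + real i + 1))"

text \<open>The length is \<open>j - 1\<close>, not \<open>j\<close> as in the theorem: the last
  factor \<open>x - y + 3j\<close> is the column factor split off from the entries.\<close>

definition poch_prod1 :: "nat \<Rightarrow> real \<Rightarrow> real" where
  "poch_prod1 m d = (\<Prod>j = 1..m. pochhammer (d + 2 * real j + 1) (j - 1))"

definition poch_prod2 :: "nat \<Rightarrow> real \<Rightarrow> real" where
  "poch_prod2 m t = (\<Prod>j = 1..m. pochhammer (t + 3 * real j + 1) (m - j))"

definition fact_prod :: "nat \<Rightarrow> real" where
  "fact_prod m = (\<Prod>j = 1..m. fact (j - 1))"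

lemma prod_atLeast1_Suc_shift: "(\<Prod>j = 1..Suc m. f j) = f 1 * (\<Prod>j = 1..m. f (Suc j))"
  for f :: "nat \<Rightarrow> 'a :: comm_monoid_mult"
  using prod.atLeast_Suc_atMost[of 1 "Suc m" f] prod.shift_bounds_cl_Suc_ivl[of f 1 m] by simp

lemma gamma_prod_Suc: "gamma_prod (Suc m) u = gamma_prod m u * Gamma (u + 2 * real m + 3)"
  by (simp add: gamma_prod_def algebra_simps)

lemma gamma_prod_Suc_shift: "gamma_prod (Suc m) u = Gamma (u + 3) * gamma_prod m (u + 2)"
  unfolding gamma_prod_def prod_atLeast1_Suc_shift by (simp add: algebra_simps)

lemma nonpos_Ints_add_nat:
  fixes z :: real
  assumes "z \<notin> \<int>\<^sub>\<le>\<^sub>0"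
  shows "z + of_nat k \<notin> \<int>\<^sub>\<le>\<^sub>0"
proof
  assume "z + of_nat k \<in> \<int>\<^sub>\<le>\<^sub>0"
  then obtain n where "z + of_nat k = - of_nat n" by (elim nonpos_Ints_cases')
  hence "z = - of_nat (n + k)" by simp
  with assms show False by (simp only: minus_of_nat_in_nonpos_Ints) simp
qed

lemma Gamma_add_nat_neq_0: "z \<notin> \<int>\<^sub>\<le>\<^sub>0 \<Longrightarrow> Gamma (z + of_nat k) \<noteq> 0" for z :: real
  using nonpos_Ints_add_nat[of z k] by (simp add: Gamma_eq_zero_iff)

lemma gamma_prod_neq_0:
  assumes "u + 3 \<notin> \<int>\<^sub>\<le>\<^sub>0"
  shows "gamma_prod m u \<noteq> 0"
proof -
  have "Gamma (u + 2 * real j + 1) \<noteq> 0" if "1 \<le> j" for j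
    using Gamma_add_nat_neq_0[OF assms, of "2 * (j - 1)"] that by (simp add: algebra_simps of_nat_diff)
  thus ?thesis by (auto simp: gamma_prod_def)
qed

lemma gamma_prod1_Suc: "gamma_prod1 (Suc m) y = gamma_prod1 m y * Gamma (y + real m + 1)"
  by (simp add: gamma_prod1_def)

lemma gamma_prod1_Suc_shift: "gamma_prod1 (Suc m) y = Gamma (y + 1) * gamma_prod1 m (y + 1)"
  unfolding gamma_prod1_def prod.lessThan_Suc_shift by (simp add: algebra_simps)

lemma gamma_prod1_neq_0:
  assumes "y + 1 \<notin> \<int>\<^sub>\<le>\<^sub>0"
  shows "gamma_prod1 m y \<noteq> 0"
proof -
  have "Gamma (y + real j + 1) \<noteq> 0" for j
    using Gamma_add_nat_neq_0[OF assms, of j] by (simp add: algebra_simps)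
  thus ?thesis by (auto simp: gamma_prod1_def)
qed

text \<open>The two sides differ only in \<open>Gamma (s + 2m + 5)\<close> against
  \<open>Gamma (s + 2m + 6)\<close>. This and the later ratio lemmas compare the factors of the
  three products in the recurrence for the closed form.\<close>

lemma gamma_prod_ratio1:
  assumes "s + 3 \<notin> \<int>\<^sub>\<le>\<^sub>0"
  shows "gamma_prod (m + 2) s * gamma_prod m (s + 3) * (s + 2 * real m + 5)
    = gamma_prod (m + 1) s * gamma_prod (m + 1) (s + 3)"
proof -
  have "Gamma ((s + 2 * real m + 5) + 1) = (s + 2 * real m + 5) * Gamma (s + 2 * real m + 5)"
    by (rule Gamma_plus1) (use nonpos_Ints_add_nat[OF assms, of "2 * m + 2"] in \<open>simp add: algebra_simps\<close>)
  thus ?thesis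
    using gamma_prod_Suc[of "m + 1" s] gamma_prod_Suc[of m "s + 3"] by (simp add: algebra_simps)
qed

lemma gamma_prod_ratio2:
  assumes "s + 3 \<notin> \<int>\<^sub>\<le>\<^sub>0"
  shows "gamma_prod (m + 1) (s + 1) * gamma_prod (m + 1) (s + 2) * (s + 2 * real m + 5)
    = (s + 3) * gamma_prod (m + 1) s * gamma_prod (m + 1) (s + 3)"
proof -
  have nz: "Gamma (s + 2 * real m + 5) \<noteq> 0" "Gamma (s + 3) \<noteq> 0"
    using Gamma_add_nat_neq_0[OF assms, of "2 * m + 2"] Gamma_add_nat_neq_0[OF assms, of 0]
    by (simp_all add: algebra_simps)
  have 1: "Gamma (s + 2 * real m + 6) = (s + 2 * real m + 5) * Gamma (s + 2 * real m + 5)"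
    using Gamma_plus1[of "s + 2 * real m + 5"] nonpos_Ints_add_nat[OF assms, of "2 * m + 2"]
    by (simp add: algebra_simps)
  have 2: "Gamma (s + 4) = (s + 3) * Gamma (s + 3)"
    using Gamma_plus1[OF assms] by (simp add: algebra_simps)
  \<comment> \<open>Parameters differing by 2 give the same product up to its end factors; this
    links \<open>s\<close> with \<open>s + 2\<close> and, in the next fact, \<open>s + 1\<close>
    with \<open>s + 3\<close>.\<close>
  have 3: "Gamma (s + 3) * gamma_prod (m + 1) (s + 2) = gamma_prod (m + 1) s * Gamma (s + 2 * real m + 5)"
    using gamma_prod_Suc[of "m + 1" s] gamma_prod_Suc_shift[of "m + 1" s] by (simp add: algebra_simps)
  have 4: "Gamma (s + 4) * gamma_prod (m + 1) (s + 3) = gamma_prod (m + 1) (s + 1) * Gamma (s + 2 * real m + 6)"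
    using gamma_prod_Suc[of "m + 1" "s + 1"] gamma_prod_Suc_shift[of "m + 1" "s + 1"]
    by (simp add: algebra_simps)
  have "(Gamma (s + 3) * Gamma (s + 2 * real m + 5)) *
      (gamma_prod (m + 1) (s + 1) * gamma_prod (m + 1) (s + 2) * (s + 2 * real m + 5))
    = (Gamma (s + 3) * Gamma (s + 2 * real m + 5)) *
      ((s + 3) * gamma_prod (m + 1) s * gamma_prod (m + 1) (s + 3))"
    using arg_cong2[OF 3 4[symmetric], of "(*)"] unfolding 1 2 by (simp only: mult_ac)
  with nz show ?thesis by simp
qed

text \<open>Here the first factors are split off: \<open>Gamma (u + 3)\<close> on the left,
  \<open>Gamma (u + 2)\<close> on the right. The denominator needs this form because its argument
  \<open>x + n\<close> moves with \<open>n\<close>.\<close>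

lemma gamma_prod_ratio3:
  assumes "u + 2 \<notin> \<int>\<^sub>\<le>\<^sub>0"
  shows "gamma_prod (m + 2) u * gamma_prod m (u + 1)
    = (u + 2) * gamma_prod (m + 1) (u - 1) * gamma_prod (m + 1) (u + 2)"
proof -
  have "Gamma (u + 3) = (u + 2) * Gamma (u + 2)"
    using Gamma_plus1[OF assms] by (simp add: algebra_simps)
  thus ?thesis
    using gamma_prod_Suc_shift[of "m + 1" u] gamma_prod_Suc_shift[of m "u - 1"]
    by (simp add: algebra_simps)
qed

lemma poch_prod1_ratio:
  "poch_prod1 (m + 2) d * poch_prod1 m (d + 3)
    = (d + 2 * real m + 5) * poch_prod1 (m + 1) d * poch_prod1 (m + 1) (d + 3)"
proof -
  have "pochhammer (d + 2 * real m + 5) (m + 1) = (d + 2 * real m + 5) * pochhammer (d + 2 * real m + 6) m"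
    by (simp add: pochhammer_rec add.commute add.left_commute)
  thus ?thesis by (simp add: poch_prod1_def algebra_simps)
qed

lemma poch_prod2_Suc: "poch_prod2 (Suc m) t = pochhammer (t + 4) m * poch_prod2 m (t + 3)"
  unfolding poch_prod2_def prod_atLeast1_Suc_shift by (simp add: algebra_simps)

text \<open>Every factor of \<open>poch_prod2 m\<close> depends on \<open>m\<close>, so the first
  factor is split off rather than the last; the rest is the same product at
  \<open>t + 3\<close>.\<close>

lemma poch_prod2_ratio:
  "poch_prod2 (m + 2) t * poch_prod2 m (t + 3)
    = (t + real m + 4) * poch_prod2 (m + 1) t * poch_prod2 (m + 1) (t + 3)"
  using poch_prod2_Suc[of "m + 1" t] poch_prod2_Suc[of m t]
  by (simp add: pochhammer_Suc algebra_simps)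

lemma gamma_prod1_ratio1:
  assumes "y + 1 \<notin> \<int>\<^sub>\<le>\<^sub>0"
  shows "gamma_prod1 (m + 2) y * gamma_prod1 m y = (y + real m + 1) * gamma_prod1 (m + 1) y * gamma_prod1 (m + 1) y"
proof -
  have "Gamma (y + real m + 2) = (y + real m + 1) * Gamma (y + real m + 1)"
    using Gamma_plus1[of "y + real m + 1"] nonpos_Ints_add_nat[OF assms, of m] by (simp add: algebra_simps)
  thus ?thesis
    using gamma_prod1_Suc[of "m + 1" y] gamma_prod1_Suc[of m y] by (simp add: algebra_simps)
qed

text \<open>Both sides equal \<open>gamma_prod1 (m + 2) y * gamma_prod1 m y\<close>.\<close>

lemma gamma_prod1_ratio2:
  assumes "y \<notin> \<int>\<^sub>\<le>\<^sub>0"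
  shows "y * gamma_prod1 (m + 1) (y + 1) * gamma_prod1 (m + 1) (y - 1)
    = (y + real m + 1) * gamma_prod1 (m + 1) y * gamma_prod1 (m + 1) y"
proof -
  have y1: "y + 1 \<notin> \<int>\<^sub>\<le>\<^sub>0" using nonpos_Ints_add_nat[OF assms, of 1] by simp
  have "Gamma (y + 1) = y * Gamma y"
    using Gamma_plus1[OF assms] .
  moreover have "gamma_prod1 (m + 2) y = Gamma (y + 1) * gamma_prod1 (m + 1) (y + 1)"
    using gamma_prod1_Suc_shift[of "m + 1" y] by simp
  moreover have "gamma_prod1 (m + 1) (y - 1) = Gamma y * gamma_prod1 m y"
    using gamma_prod1_Suc_shift[of m "y - 1"] by simp
  ultimately have "y * gamma_prod1 (m + 1) (y + 1) * gamma_prod1 (m + 1) (y - 1)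
      = gamma_prod1 (m + 2) y * gamma_prod1 m y" by simp
  with gamma_prod1_ratio1[OF y1] show ?thesis by simp
qed

lemma fact_prod_ratio: "fact_prod (m + 2) * fact_prod m = (real m + 1) * fact_prod (m + 1) * fact_prod (m + 1)"
  by (simp add: fact_prod_def algebra_simps)

text \<open>The product of the theorem without the column factors \<open>x - y + 3j\<close>, with
  Gamma in place of those factorials that involve \<open>x\<close> or \<open>y\<close>.\<close>

definition closed_form :: "nat \<Rightarrow> nat \<Rightarrow> real \<Rightarrow> real" where
  "closed_form n x y = fact_prod n * gamma_prod n (x + y) * poch_prod1 n (x - y) * poch_prod2 n (x + 2 * y)
     / (gamma_prod n (x + n) * gamma_prod1 n y)"

lemma pos_notin_nonpos_Ints: "u > 0 \<Longrightarrow> u \<notin> \<int>\<^sub>\<le>\<^sub>0" for u :: real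
  by (auto elim!: nonpos_Ints_cases)

lemma notin_Ints_imp_notin_nonpos_Ints: "u \<notin> \<int> \<Longrightarrow> u \<notin> \<int>\<^sub>\<le>\<^sub>0" for u :: real
  using nonpos_Ints_Int by blast

text \<open>All three products are rational multiples of \<open>K\<close>, the first one on the
  right. Dividing by \<open>K\<close> and clearing denominators leaves the polynomial identity
  \<open>key\<close>.\<close>

lemma closed_form_recurrence:
  fixes x m :: nat and y :: real
  assumes y: "y \<notin> \<int>"
  shows "closed_form (m + 2) x y * closed_form m (x + 3) y
    = closed_form (m + 1) x y * closed_form (m + 1) (x + 3) y
      - closed_form (m + 1) (x + 1) (y + 1) * closed_form (m + 1) (x + 2) (y - 1)"
proof -
  \<comment> \<open>The two products on the right use the same arguments \<open>d\<close>,
    \<open>d + 3\<close> and \<open>t\<close>, \<open>t + 3\<close>, so their Pochhammer parts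
    agree. The denominator arguments \<open>x + n\<close> all lie between \<open>u - 1\<close> and
    \<open>u + 2\<close>.\<close>
  define s d t u where "s = x + y" and "d = x - y" and "t = x + 2 * y" and "u = real (x + m + 2)"
  have shift: "y + real_of_int k \<notin> \<int>\<^sub>\<le>\<^sub>0" for k
    using y by (intro notin_Ints_imp_notin_nonpos_Ints) (metis Ints_diff Ints_of_int add_diff_cancel_right')
  have s3: "s + 3 \<notin> \<int>\<^sub>\<le>\<^sub>0" using shift[of "int x + 3"] by (simp add: s_def algebra_simps)
  have y0: "y \<notin> \<int>\<^sub>\<le>\<^sub>0" and y1: "y + 1 \<notin> \<int>\<^sub>\<le>\<^sub>0" using shift[of 0] shift[of 1] by simp_all
  have nz: "s + 2 * real m + 5 \<noteq> 0" "y + real m + 1 \<noteq> 0" "y \<noteq> 0"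
    using shift[of "int x + 2 * int m + 5"] shift[of "int m + 1"] shift[of 0] by (auto simp: s_def algebra_simps)
  have u: "u > 0" "u + 2 * real m + 4 > 0" by (auto simp: u_def)
  note up = pos_notin_nonpos_Ints
  define K where "K = closed_form (m + 1) x y * closed_form (m + 1) (x + 3) y"
  let ?S = "s + 2 * real m + 5" and ?U = "u + 2" and ?Y = "y + real m + 1"
  let ?k = "m + 1"
  have K: "K = fact_prod ?k * fact_prod ?k * (gamma_prod ?k s * gamma_prod ?k (s + 3))
       * (poch_prod1 ?k d * poch_prod1 ?k (d + 3)) * (poch_prod2 ?k t * poch_prod2 ?k (t + 3))
       / ((gamma_prod ?k (u - 1) * gamma_prod ?k (u + 2)) * (gamma_prod1 ?k y * gamma_prod1 ?k y))"
    by (simp add: K_def closed_form_def s_def d_def t_def u_def algebra_simps)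
  have L: "closed_form (m + 2) x y * closed_form m (x + 3) y
     = (fact_prod (m + 2) * fact_prod m) * (gamma_prod (m + 2) s * gamma_prod m (s + 3))
       * (poch_prod1 (m + 2) d * poch_prod1 m (d + 3)) * (poch_prod2 (m + 2) t * poch_prod2 m (t + 3))
       / ((gamma_prod (m + 2) u * gamma_prod m (u + 1)) * (gamma_prod1 (m + 2) y * gamma_prod1 m y))"
    by (simp add: closed_form_def s_def d_def t_def u_def algebra_simps)
  have R: "closed_form ?k (x + 1) (y + 1) * closed_form ?k (x + 2) (y - 1)
     = fact_prod ?k * fact_prod ?k * (gamma_prod ?k (s + 1) * gamma_prod ?k (s + 2))
       * (poch_prod1 ?k d * poch_prod1 ?k (d + 3)) * (poch_prod2 ?k t * poch_prod2 ?k (t + 3))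
       / ((gamma_prod ?k u * gamma_prod ?k (u + 1)) * (gamma_prod1 ?k (y + 1) * gamma_prod1 ?k (y - 1)))"
    by (simp add: closed_form_def s_def d_def t_def u_def algebra_simps)
  have G1: "gamma_prod (m + 2) s * gamma_prod m (s + 3) = gamma_prod ?k s * gamma_prod ?k (s + 3) / ?S"
    using gamma_prod_ratio1[OF s3, of m] nz by (simp add: field_simps)
  have G2: "gamma_prod ?k (s + 1) * gamma_prod ?k (s + 2) = (s + 3) * (gamma_prod ?k s * gamma_prod ?k (s + 3)) / ?S"
    using gamma_prod_ratio2[OF s3, of m] nz by (simp add: field_simps)
  have G3: "gamma_prod (m + 2) u * gamma_prod m (u + 1) = ?U * (gamma_prod ?k (u - 1) * gamma_prod ?k (u + 2))"
    using gamma_prod_ratio3[of u m] u by (simp add: up)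
  have G4: "gamma_prod ?k u * gamma_prod ?k (u + 1) = ?U * (gamma_prod ?k (u - 1) * gamma_prod ?k (u + 2)) / (u + 2 * real m + 4)"
    using gamma_prod_ratio2[of "u - 1" m] u by (simp add: up field_simps)
  have H2: "gamma_prod1 ?k (y + 1) * gamma_prod1 ?k (y - 1) = ?Y * (gamma_prod1 ?k y * gamma_prod1 ?k y) / y"
    using gamma_prod1_ratio2[OF y0, of m] nz by (simp add: field_simps)
  have L': "closed_form (m + 2) x y * closed_form m (x + 3) y
     = K * ((real m + 1) * (d + 2 * real m + 5) * (t + real m + 4) / (?S * ?U * ?Y))"
    unfolding L K G1 G3 fact_prod_ratio poch_prod1_ratio poch_prod2_ratio gamma_prod1_ratio1[OF y1]
    by (simp add: mult_ac)
  have R': "closed_form ?k (x + 1) (y + 1) * closed_form ?k (x + 2) (y - 1)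
     = K * ((s + 3) * (u + 2 * real m + 4) * y / (?S * ?U * ?Y))"
    unfolding R K G2 G4 H2 by (simp add: mult_ac)
  have key: "(real m + 1) * (d + 2 * real m + 5) * (t + real m + 4) = ?S * ?U * ?Y - (s + 3) * (u + 2 * real m + 4) * y"
    by (simp add: s_def d_def t_def u_def algebra_simps)
  have "?S * ?U * ?Y \<noteq> 0" using nz u by simp
  hence "(real m + 1) * (d + 2 * real m + 5) * (t + real m + 4) / (?S * ?U * ?Y)
      = 1 - (s + 3) * (u + 2 * real m + 4) * y / (?S * ?U * ?Y)"
    unfolding key by (simp add: diff_divide_distrib)
  hence "K * ((real m + 1) * (d + 2 * real m + 5) * (t + real m + 4) / (?S * ?U * ?Y))
      = K - K * ((s + 3) * (u + 2 * real m + 4) * y / (?S * ?U * ?Y))"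
    by (simp only: right_diff_distrib mult_1_right)
  thus ?thesis unfolding L' R' K_def .
qed

text \<open>Linear factors in \<open>x - y\<close> vanish only at integral \<open>y\<close>, those
  in \<open>x + 2y\<close> only at integral \<open>2y\<close>. Gamma has value 0 only at its poles,
  which are avoided.\<close>

lemma closed_form_neq_0:
  assumes "2 * y \<notin> \<int>"
  shows "closed_form n x y \<noteq> 0"
proof -
  have y: "y \<notin> \<int>" using assms by (metis Ints_mult Ints_numeral)
  have shift: "y + real_of_int k \<notin> \<int>" for k
    using y by (metis Ints_diff Ints_of_int add_diff_cancel_right')
  have shift2: "2 * y + real_of_int k \<notin> \<int>" for k
    using assms by (metis Ints_diff Ints_of_int add_diff_cancel_right')
  have d: "real x - y + 2 * real j + 1 + real k \<noteq> 0" for j k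
    using shift[of "- (int x + 2 * int j + 1 + int k)"] by (auto simp: algebra_simps)
  have t: "real x + 2 * y + 3 * real j + 1 + real k \<noteq> 0" for j k
  proof
    assume "real x + 2 * y + 3 * real j + 1 + real k = 0"
    hence "2 * y + real_of_int (int x + 3 * int j + 1 + int k) = 0" by simp
    thus False using shift2 by (metis Ints_0)
  qed
  have "poch_prod1 n (x - y) \<noteq> 0"
    using d by (auto simp: poch_prod1_def pochhammer_eq_0_iff add_eq_0_iff2)
  moreover have "poch_prod2 n (x + 2 * y) \<noteq> 0"
    using t by (auto simp: poch_prod2_def pochhammer_eq_0_iff add_eq_0_iff2)
  moreover have "gamma_prod n (x + y) \<noteq> 0"
    using shift[of "int x + 3"]
    by (intro gamma_prod_neq_0 notin_Ints_imp_notin_nonpos_Ints) (simp add: algebra_simps)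
  moreover have "gamma_prod n (x + n) \<noteq> 0"
    by (intro gamma_prod_neq_0 pos_notin_nonpos_Ints) simp
  moreover have "gamma_prod1 n y \<noteq> 0"
    using shift[of 1] by (intro gamma_prod1_neq_0 notin_Ints_imp_notin_nonpos_Ints) simp
  moreover have "fact_prod n \<noteq> 0" by (simp add: fact_prod_def)
  ultimately show ?thesis by (simp add: closed_form_def)
qed

section \<open>Evaluation of the determinant for generic \<open>y\<close>\<close>

text \<open>\<open>rGamma\<close> is the entire function \<open>1/Gamma\<close>; its zeros account for the entries with \<open>j > y + i\<close>.\<close>

definition gamma_entry :: "nat \<Rightarrow> real \<Rightarrow> nat \<Rightarrow> nat \<Rightarrow> real" where
  "gamma_entry x y i j = Gamma (x + y + 2 * real i + real j) / fact (x + i + 2 * j) * rGamma (y + real i - real j + 1)"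

text \<open>The entry depends on three linear combinations only. Hence raising \<open>i\<close>
  amounts to \<open>(x + 1, y + 1)\<close>, raising \<open>j\<close> to
  \<open>(x + 2, y - 1)\<close>, and raising both to \<open>(x + 3, y)\<close>.\<close>

lemma gamma_entry_eqI:
  assumes "x + i + 2 * j = x' + i' + 2 * j'"
    and "x + y + 2 * real i + real j = x' + y' + 2 * real i' + real j'"
    and "y + real i - real j = y' + real i' - real j'"
  shows "gamma_entry x y i j = gamma_entry x' y' i' j'"
  by (simp only: gamma_entry_def assms)

lemma det_gamma_entry_generic:
  assumes "2 * y \<notin> \<int>"
  shows "det\<^sub>1 n (gamma_entry x y) = closed_form n x y"
  using assms
proof (induction n arbitrary: x y rule: less_induct)
  case (less n)
  consider "n = 0" | "n = 1" | m where "n = m + 2"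
    by (metis One_nat_def add_2_eq_Suc' not0_implies_Suc)
  then show ?case
  proof cases
    case 1
    then show ?thesis
      by (simp add: det\<^sub>1_def closed_form_def fact_prod_def gamma_prod_def gamma_prod1_def poch_prod1_def poch_prod2_def)
  next
    case 2
    have "real x + 4 = 1 + of_nat (x + 1 + 2 * 1)" by simp
    hence "fact (x + 1 + 2 * 1) = Gamma (real x + 4)" by (simp only: Gamma_fact)
    hence "gamma_entry x y 1 1 = Gamma (real x + y + 3) / Gamma (real x + 4) * rGamma (y + 1)"
      unfolding gamma_entry_def by (simp only:) (simp add: add_ac)
    with 2 show ?thesis
      by (simp add: det\<^sub>1_def det_single closed_form_def fact_prod_def gamma_prod_def gamma_prod1_def
          poch_prod1_def poch_prod2_def rGamma_inverse_Gamma divide_inverse add_ac)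
  next
    case 3
    have y: "y \<notin> \<int>" using less.prems by (metis Ints_mult Ints_numeral)
    have shift: "2 * (y + 1) \<notin> \<int>" "2 * (y - 1) \<notin> \<int>"
      using less.prems Ints_diff[of "2 * y + 2" 2] Ints_add[of "2 * y - 2" 2] by (auto simp: algebra_simps)
    have e: "(\<lambda>i j. gamma_entry x y (i + 1) (j + 1)) = gamma_entry (x + 3) y"
      "(\<lambda>i j. gamma_entry x y (i + 1) j) = gamma_entry (x + 1) (y + 1)"
      "(\<lambda>i j. gamma_entry x y i (j + 1)) = gamma_entry (x + 2) (y - 1)"
      by (intro ext gamma_entry_eqI; simp)+
    note IH = less.IH[unfolded 3]
    \<comment> \<open>By induction the smaller determinants are closed forms, so both recurrences
      have the same right-hand side; the common nonzero factor then cancels.\<close>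
    have "det\<^sub>1 n (gamma_entry x y) * closed_form m (x + 3) y
       = closed_form n x y * closed_form m (x + 3) y"
      using det\<^sub>1_Desnanot_Jacobi[of m "gamma_entry x y"] closed_form_recurrence[OF y, of m x]
      unfolding e 3 by (simp add: IH shift less.prems)
    thus ?thesis using closed_form_neq_0[OF less.prems] by simp
  qed
qed

subsection \<open>Row reduction to a product entry\<close>

text \<open>In this form, column scaling and continuity in the entries can be read off.\<close>

lemma det\<^sub>1_leibniz:
  "det\<^sub>1 n a = (\<Sum>p | p permutes {0..<n}. signof p * (\<Prod>j<n. a (Suc (p j)) (Suc j)))"
proof -
  have "det\<^sub>1 n a = (\<Sum>p | p permutes {0..<n}. signof p * (\<Prod>j<n. mat n n (\<lambda>(i, j). a (Suc i) (Suc j)) $$ (p j, j)))"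
    unfolding det\<^sub>1_def by (rule det_col) simp
  also have "\<dots> = (\<Sum>p | p permutes {0..<n}. signof p * (\<Prod>j<n. a (Suc (p j)) (Suc j)))"
    by (intro sum.cong prod.cong refl arg_cong2[of _ _ _ _ "(*)"]) (auto simp: permutes_in_image atLeast0LessThan[symmetric])
  finally show ?thesis .
qed

lemma det\<^sub>1_mult_columns: "det\<^sub>1 n (\<lambda>i j. c j * a i j) = (\<Prod>j = 1..n. c j) * det\<^sub>1 n a"
proof -
  have "(\<Prod>j = 1..n. c j) = (\<Prod>j<n. c (Suc j))"
    by (simp add: prod.atLeast1_atMost_eq)
  thus ?thesis by (simp add: det\<^sub>1_leibniz prod.distrib sum_distrib_left mult_ac)
qed

lemma det\<^sub>1_unitriangular_rows:
  fixes a b c :: "nat \<Rightarrow> nat \<Rightarrow> 'a :: idom"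
  assumes b: "\<And>i j. \<lbrakk>1 \<le> i; i \<le> n; 1 \<le> j; j \<le> n\<rbrakk> \<Longrightarrow> b i j = (\<Sum>k = 1..n. c i k * a k j)"
    and c: "\<And>i. 1 \<le> i \<Longrightarrow> c i i = 1" "\<And>i k. 1 \<le> i \<Longrightarrow> i < k \<Longrightarrow> c i k = 0"
  shows "det\<^sub>1 n b = det\<^sub>1 n a"
proof -
  define A where "A = mat n n (\<lambda>(i, j). a (Suc i) (Suc j))"
  define C where "C = mat n n (\<lambda>(i, j). c (Suc i) (Suc j))"
  have AC: "A \<in> carrier_mat n n" "C \<in> carrier_mat n n" by (simp_all add: A_def C_def)
  have "mat n n (\<lambda>(i, j). b (Suc i) (Suc j)) = C * A"
  proof (rule eq_matI)
    fix i j assume "i < dim_row (C * A)" "j < dim_col (C * A)"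
    hence ij: "i < n" "j < n" using AC by auto
    have "b (Suc i) (Suc j) = (\<Sum>k = 1..n. c (Suc i) k * a k (Suc j))" using ij by (intro b) auto
    also have "\<dots> = (\<Sum>k = 0..<n. c (Suc i) (Suc k) * a (Suc k) (Suc j))"
      by (simp add: sum.atLeast1_atMost_eq atLeast0LessThan)
    finally show "mat n n (\<lambda>(i, j). b (Suc i) (Suc j)) $$ (i, j) = (C * A) $$ (i, j)"
      using ij by (simp add: A_def C_def scalar_prod_def)
  qed (use AC in auto)
  moreover have "det C = 1"
  proof -
    have "det C = prod_list (diag_mat C)"
      by (rule det_lower_triangular[of n]) (use c(2) AC in \<open>auto simp: C_def\<close>)
    also have "diag_mat C = replicate n 1"
      by (rule nth_equalityI) (auto simp: diag_mat_def C_def c(1))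
    finally show ?thesis by simp
  qed
  ultimately show ?thesis
    using det_mult[OF AC(2,1)] by (simp add: det\<^sub>1_def A_def)
qed

text \<open>Coefficients of the \<open>i\<close>-th power of the row operator \<open>f(l) \<mapsto> f(l-1) + 2 f(l) + f(l+1)\<close>, acting on
  functions with \<open>f(0) = 0\<close>. Since \<open>f\<close> is a difference of reflected binomial coefficients, two
  applications of Pascal's rule turn this operator into a shift of the upper and lower index.\<close>

fun row_coeff :: "nat \<Rightarrow> nat \<Rightarrow> nat \<Rightarrow> 'a :: comm_ring_1" where
  "row_coeff i 0 k = 0"
| "row_coeff 0 (Suc l) k = of_bool (k = Suc l)"
| "row_coeff (Suc i) (Suc l) k = row_coeff i l k + 2 * row_coeff i (Suc l) k + row_coeff i (Suc (Suc l)) k"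

lemma row_coeff_eq_0: "i + l < k \<Longrightarrow> row_coeff i l k = 0"
  by (induction i l k rule: row_coeff.induct) auto

text \<open>Each application reaches one row further, with coefficient 1. This gives the unit
  diagonal of the row operations.\<close>

lemma row_coeff_eq_1: "row_coeff i (Suc l) (i + Suc l) = 1"
proof (induction i arbitrary: l)
  case (Suc i)
  then show ?case using Suc.IH[of "Suc l"] by (simp add: row_coeff_eq_0)
qed simp

text \<open>In the theorem \<open>K = x + 2j\<close> and \<open>l\<close> is the row index. The
  function is odd in \<open>l\<close>, so it vanishes at \<open>l = 0\<close>.\<close>

definition binom_diff :: "nat \<Rightarrow> int \<Rightarrow> int \<Rightarrow> int" where
  "binom_diff N K l = int (binom_int N (K - l)) - int (binom_int N (K + l))"

lemma binom_int_Suc: "binom_int (Suc N) k = binom_int N k + binom_int N (k - 1)"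
proof (cases "k \<le> 0")
  case False
  then obtain q where "k = int (Suc q)" by (metis int_ops(4) nonneg_int_cases not_le zero_less_imp_eq_int gr0_conv_Suc)
  then show ?thesis by (simp add: binom_int_def nat_add_distrib)
qed (auto simp: binom_int_def)

lemma binom_diff_Suc_Suc:
  "binom_diff (N + 2) (K + 1) l = binom_diff N K (l - 1) + 2 * binom_diff N K l + binom_diff N K (l + 1)"
  by (simp add: binom_diff_def binom_int_Suc numeral_2_eq_2 algebra_simps)

text \<open>The bound \<open>i + l \<le> n\<close> keeps every row reached within
  \<open>1..n\<close>; row 0 contributes nothing.\<close>

lemma binom_diff_row_coeff:
  "i + l \<le> n \<Longrightarrow> binom_diff (N + 2 * i) (K + int i) (int l)
     = (\<Sum>k = 1..n. row_coeff i l k * binom_diff N K (int k))"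
proof (induction i arbitrary: l)
  case 0
  show ?case
  proof (cases l)
    case (Suc m)
    with 0 have "(\<Sum>k = 1..n. row_coeff 0 l k * binom_diff N K (int k)) = (\<Sum>k = 1..n. if k = l then binom_diff N K (int l) else 0)"
      by (intro sum.cong) auto
    with 0 Suc show ?thesis by simp
  qed (simp add: binom_diff_def)
next
  case (Suc i)
  show ?case
  proof (cases l)
    case (Suc m)
    have "binom_diff (N + 2 * Suc i) (K + int (Suc i)) (int l)
      = binom_diff (N + 2 * i) (K + int i) (int m) + 2 * binom_diff (N + 2 * i) (K + int i) (int (Suc m))
        + binom_diff (N + 2 * i) (K + int i) (int (Suc (Suc m)))"
      using binom_diff_Suc_Suc[of "N + 2 * i" "K + int i" "int l"] Suc by (simp add: algebra_simps)
    also have "\<dots> = (\<Sum>k = 1..n. row_coeff i m k * binom_diff N K (int k))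
        + 2 * (\<Sum>k = 1..n. row_coeff i (Suc m) k * binom_diff N K (int k))
        + (\<Sum>k = 1..n. row_coeff i (Suc (Suc m)) k * binom_diff N K (int k))"
      using Suc Suc.prems by (simp only: Suc.IH)
    also have "\<dots> = (\<Sum>k = 1..n. row_coeff (Suc i) l k * binom_diff N K (int k))"
      unfolding Suc row_coeff.simps distrib_right sum.distrib sum_distrib_left by (simp only: mult.assoc)
    finally show ?thesis .
  qed (simp add: binom_diff_def)
qed

section \<open>Factorial form of the reduced entries\<close>

text \<open>After multiplication by \<open>k! l!\<close> the binomials become
  \<open>M! k (k - 1)\<close> and \<open>M! l (l - 1)\<close>, whose difference is
  \<open>M! (k + l - 1) (k - l)\<close>, and \<open>k + l - 1 = M + 1\<close>.\<close>

lemma binom_diff_eq_fact: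
  assumes "k + l = M + 2" "2 \<le> k"
  shows "(fact k * fact l :: real) * of_int (int (M choose (k - 2)) - int (M choose k))
    = fact (M + 1) * (real k - real l)"
proof -
  obtain q where k: "k = q + 2" using assms(2) by (metis add.commute le_Suc_ex)
  with assms have M: "M = q + l" by simp
  have f: "real (M choose q) * (fact q * fact l) = fact M"
  proof -
    have "q \<le> M" "M - q = l" using M by simp_all
    thus ?thesis using arg_cong[OF binomial_fact_lemma[of q M], of real]
      by (simp only: of_nat_mult of_nat_fact mult_ac)
  qed
  have k1: "fact k = real k * (real k - 1) * fact q"
    unfolding k by (simp add: algebra_simps)
  have 1: "real (M choose q) * (fact k * fact l) = fact M * (real k * (real k - 1))"
    unfolding k1 f[symmetric] by (simp only: mult_ac)
  have 2: "real (M choose k) * (fact k * fact l) = fact M * (real l * (real l - 1))"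
  proof (cases "l \<ge> 2")
    case True
    then obtain r where l: "l = r + 2" by (metis add.commute le_Suc_ex)
    have *: "real (M choose k) * (fact k * fact r) = fact M"
    proof -
      have "k \<le> M" "M - k = r" using M k l by simp_all
      thus ?thesis using arg_cong[OF binomial_fact_lemma[of k M], of real]
        by (simp only: of_nat_mult of_nat_fact mult_ac)
    qed
    have "fact l = real l * (real l - 1) * fact r" unfolding l by (simp add: algebra_simps)
    thus ?thesis unfolding *[symmetric] by (simp only: mult_ac)
  next
    \<comment> \<open>For \<open>l < 2\<close> both \<open>M choose k\<close> and
      \<open>l (l - 1)\<close> are zero.\<close>
    case False
    hence "l = 0 \<or> l = 1" by auto
    thus ?thesis unfolding M k by (auto simp: binomial_eq_0)
  qed
  have 3: "fact (M + 1) = fact M * (real k + real l - 1)"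
    unfolding M k by (simp add: algebra_simps)
  have "(fact k * fact l :: real) * of_int (int (M choose (k - 2)) - int (M choose k))
      = real (M choose q) * (fact k * fact l) - real (M choose k) * (fact k * fact l)"
    by (simp only: k add_diff_cancel_right' of_int_diff of_int_of_nat_eq right_diff_distrib mult_ac)
  also have "\<dots> = fact (M + 1) * (real k - real l)"
    unfolding 1 2 3 by (simp add: algebra_simps)
  finally show ?thesis .
qed

lemma reduced_entry:
  assumes "1 \<le> i" "1 \<le> j"
  shows "of_int (binom_diff (x + y + j + 2 * (i - 1)) (int x + 2 * int j + int (i - 1)) 1)
    = (real x - real y + 3 * real j) * gamma_entry x (real y) i j"
proof -
  define k M where "k = x + i + 2 * j" and "M = x + y + j + 2 * (i - 1)"
  show ?thesis
  proof (cases "j \<le> y + i")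
    case True
    then obtain l where l: "y + i = j + l" by (metis le_Suc_ex)
    have kl: "k + l = M + 2" "2 \<le> k" using l assms by (auto simp: k_def M_def)
    have "binom_diff M (int x + 2 * int j + int (i - 1)) 1 = int (M choose (k - 2)) - int (M choose k)"
    proof -
      have "int x + 2 * int j + int (i - 1) - 1 = int (k - 2)" "int x + 2 * int j + int (i - 1) + 1 = int k"
        using assms by (auto simp: k_def of_nat_diff)
      thus ?thesis by (simp only: binom_diff_def binom_int_def nat_int of_nat_less_0_iff if_False)
    qed
    hence "(fact k * fact l :: real) * of_int (binom_diff M (int x + 2 * int j + int (i - 1)) 1)
        = fact (M + 1) * (real k - real l)"
      using binom_diff_eq_fact[OF kl] by simp
    moreover have "gamma_entry x (real y) i j = fact (M + 1) / (fact k * fact l)"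
    proof -
      have "real x + real y + 2 * real i + real j = 1 + of_nat (M + 1)" "real y + real i - real j + 1 = 1 + of_nat l"
        using l assms by (auto simp: M_def of_nat_diff)
      thus ?thesis unfolding gamma_entry_def
        by (simp only: Gamma_fact rGamma_inverse_Gamma) (simp add: k_def divide_inverse mult_ac)
    qed
    \<comment> \<open>The row index cancels, so this factor can be taken out of the columns.\<close>
    moreover have "real k - real l = real x - real y + 3 * real j"
      using l unfolding k_def by linarith
    ultimately have "(fact k * fact l :: real) * of_int (binom_diff M (int x + 2 * int j + int (i - 1)) 1)
        = (fact k * fact l) * ((real x - real y + 3 * real j) * gamma_entry x (real y) i j)"
      by (simp del: fact_Suc)
    thus ?thesis unfolding M_def by simp
  next
    case False
    \<comment> \<open>The argument of \<open>rGamma\<close> is one of its zeros; on the other side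
      both lower indices exceed the upper index \<open>M\<close>.\<close>
    have "real y + real i - real j + 1 = - of_nat (j - (y + i + 1))"
      using False by (simp add: of_nat_diff)
    hence "rGamma (real y + real i - real j + 1) = 0"
      by (simp only: rGamma_eq_zero_iff minus_of_nat_in_nonpos_Ints)
    moreover have "binom_diff M (int x + 2 * int j + int (i - 1)) 1 = 0"
    proof -
      have "int x + 2 * int j + int (i - 1) - 1 = int (x + 2 * j + i - 2)"
        "int x + 2 * int j + int (i - 1) + 1 = int k"
        using assms by (auto simp: k_def of_nat_diff)
      moreover have "M < x + 2 * j + i - 2" "M < k" using False assms by (auto simp: M_def k_def)
      ultimately show ?thesis
        by (simp only: binom_diff_def binom_int_def nat_int of_nat_less_0_iff if_False binomial_eq_0 of_nat_0 diff_self)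
    qed
    ultimately show ?thesis unfolding M_def by (simp add: gamma_entry_def)
  qed
qed

subsection \<open>Integral parameters\<close>

lemma tendsto_det\<^sub>1:
  fixes a :: "'b \<Rightarrow> nat \<Rightarrow> nat \<Rightarrow> real"
  assumes "\<And>i j. \<lbrakk>1 \<le> i; i \<le> n; 1 \<le> j; j \<le> n\<rbrakk> \<Longrightarrow> ((\<lambda>k. a k i j) \<longlongrightarrow> b i j) F"
  shows "((\<lambda>k. det\<^sub>1 n (a k)) \<longlongrightarrow> det\<^sub>1 n b) F"
  unfolding det\<^sub>1_leibniz
proof (intro tendsto_sum tendsto_mult tendsto_const tendsto_prod)
  fix p j assume "p \<in> {p. p permutes {0..<n}}" "j \<in> {..<n}"
  hence "p j < n" "j < n" using permutes_in_image[of p "{0..<n}" j] by auto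
  thus "((\<lambda>k. a k (Suc (p j)) (Suc j)) \<longlongrightarrow> b (Suc (p j)) (Suc j)) F"
    by (intro assms) auto
qed

text \<open>At a limit \<open>y \<ge> 0\<close> all Gamma arguments are positive, so no pole is met
  and the denominator is nonzero.\<close>

lemma tendsto_closed_form:
  assumes "(Y \<longlongrightarrow> y) F" "y \<ge> 0"
  shows "((\<lambda>k. closed_form n x (Y k)) \<longlongrightarrow> closed_form n x y) F"
proof -
  note pochhammer = isCont_tendsto_compose[OF isCont_pochhammer]
  have "gamma_prod n (real x + real n) * gamma_prod1 n y \<noteq> 0"
    using assms(2) by (auto intro!: gamma_prod_neq_0 gamma_prod1_neq_0 pos_notin_nonpos_Ints simp del: of_nat_add)
  thus ?thesis
    unfolding closed_form_def gamma_prod_def gamma_prod1_def poch_prod1_def poch_prod2_def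
    using assms(2)
    by (intro tendsto_divide tendsto_mult tendsto_prod tendsto_const tendsto_Gamma pochhammer tendsto_add
        tendsto_diff assms(1) pos_notin_nonpos_Ints) (auto intro!: add_nonneg_pos)
qed

lemma tendsto_gamma_entry:
  assumes "(Y \<longlongrightarrow> y) F" "y \<ge> 0" "1 \<le> i"
  shows "((\<lambda>k. gamma_entry x (Y k) i j) \<longlongrightarrow> gamma_entry x y i j) F"
proof -
  have rGamma: "isCont rGamma z" for z :: real
    by (rule DERIV_isCont[OF has_field_derivative_rGamma])
  show ?thesis
    unfolding gamma_entry_def
    by (intro tendsto_mult tendsto_divide tendsto_Gamma isCont_tendsto_compose[OF rGamma] tendsto_add
        tendsto_diff tendsto_const assms(1) pos_notin_nonpos_Ints) (use assms in auto)
qed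

lemma det_gamma_entry: "det\<^sub>1 n (gamma_entry x (real y)) = closed_form n x (real y)"
proof -
  \<comment> \<open>The offset 3 makes \<open>2 * Y k\<close> exceed an integer by
    \<open>2 / (k + 3)\<close>, strictly between 0 and 1.\<close>
  define Y where "Y k = real y + 1 / real (k + 3)" for k :: nat
  have "2 * Y k \<notin> \<int>" for k
  proof
    assume "2 * Y k \<in> \<int>"
    hence "2 * Y k - of_nat (2 * y) \<in> \<int>" by (intro Ints_diff Ints_of_nat)
    hence "2 / real (k + 3) \<in> \<int>" by (simp add: Y_def)
    then obtain z where z: "2 / real (k + 3) = of_int z" by (elim Ints_cases)
    have "0 < 2 / real (k + 3)" "2 / real (k + 3) < 1" by simp_all
    thus False unfolding z by simp
  qed
  hence *: "det\<^sub>1 n (gamma_entry x (Y k)) = closed_form n x (Y k)" for k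
    by (rule det_gamma_entry_generic)
  have "Y \<longlonglongrightarrow> real y + 0"
    unfolding Y_def by (intro tendsto_add tendsto_const LIMSEQ_ignore_initial_segment lim_1_over_n)
  hence Y: "Y \<longlonglongrightarrow> real y" by simp
  have "(\<lambda>k. det\<^sub>1 n (gamma_entry x (Y k))) \<longlonglongrightarrow> det\<^sub>1 n (gamma_entry x (real y))"
    by (intro tendsto_det\<^sub>1 tendsto_gamma_entry Y) auto
  moreover have "(\<lambda>k. det\<^sub>1 n (gamma_entry x (Y k))) \<longlonglongrightarrow> closed_form n x (real y)"
    unfolding * by (intro tendsto_closed_form Y) auto
  ultimately show ?thesis by (rule LIMSEQ_unique)
qed

section \<open>Return to factorials and transfer to the rationals\<close>

text \<open>The column factor \<open>x - y + 3j\<close> is the last factor of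
  \<open>(x - y + 2j + 1)_j\<close>, so it completes the shortened Pochhammer symbol.\<close>

lemma closed_form_nat:
  "(\<Prod>j = 1..n. real x - real y + 3 * real j) * closed_form n x (real y)
    = (\<Prod>j = 1..n. fact (j - 1) * fact (x + y + 2 * j)
        * pochhammer (real x - real y + 2 * real j + 1) j
        * pochhammer (real x + 2 * real y + 3 * real j + 1) (n - j)
        / (fact (x + n + 2 * j) * fact (y + n - j)))"
proof -
  have Gamma: "Gamma (real a + 2 * real j + 1) = fact (a + 2 * j)" for a j
    using Gamma_fact[of "a + 2 * j", where ?'a = real] by (simp add: add_ac)
  have G: "gamma_prod n (real a) = (\<Prod>j = 1..n. fact (a + 2 * j))" for a
    by (simp add: gamma_prod_def Gamma)
  have "gamma_prod1 n (real y) = (\<Prod>i<n. fact (y + i))"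
    unfolding gamma_prod1_def using Gamma_fact[of "y + _", where ?'a = real] by (simp add: add_ac)
  also have "\<dots> = (\<Prod>i<n. fact (y + (n - Suc i)))" by (rule prod.nat_diff_reindex[symmetric])
  also have "\<dots> = (\<Prod>j = 1..n. fact (y + n - j))"
    unfolding One_nat_def prod.atLeast1_atMost_eq by (intro prod.cong) auto
  finally have H: "gamma_prod1 n (real y) = (\<Prod>j = 1..n. fact (y + n - j))" .
  have poch: "pochhammer (real x - real y + 2 * real j + 1) j
      = (real x - real y + 3 * real j) * pochhammer (real x - real y + 2 * real j + 1) (j - 1)"
    if j: "j \<in> {1..n}" for j
  proof -
    obtain i where "j = Suc i" using j by (cases j) auto
    thus ?thesis by (simp add: pochhammer_Suc algebra_simps)
  qed
  have "closed_form n x (real y) = (\<Prod>j = 1..n. fact (j - 1) * fact (x + y + 2 * j)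
        * pochhammer (real x - real y + 2 * real j + 1) (j - 1)
        * pochhammer (real x + 2 * real y + 3 * real j + 1) (n - j)
        / (fact (x + n + 2 * j) * fact (y + n - j)))"
    unfolding closed_form_def H G of_nat_add[symmetric] fact_prod_def poch_prod1_def poch_prod2_def
    by (simp only: prod.distrib prod_dividef)
  thus ?thesis
    by (simp only: prod.distrib[symmetric]) (intro prod.cong refl, simp only: poch, simp)
qed

lemma of_rat_pochhammer: "(of_rat (pochhammer a k) :: 'a :: field_char_0) = pochhammer (of_rat a) k"
  by (induction k) (simp_all add: pochhammer_Suc of_rat_mult of_rat_add)

lemma of_rat_fact: "(of_rat (fact k) :: 'a :: field_char_0) = fact k"
  by (metis of_nat_fact of_rat_of_nat_eq)

lemma of_rat_det\<^sub>1: "(of_rat (det\<^sub>1 n a) :: 'a :: field_char_0) = det\<^sub>1 n (\<lambda>i j. of_rat (a i j))"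
proof -
  have "of_rat (det\<^sub>1 n a) = (det (map_mat of_rat (mat n n (\<lambda>(i, j). a (Suc i) (Suc j)))) :: 'a)"
    unfolding det\<^sub>1_def
    by (rule comm_ring_hom.hom_det[symmetric]) (unfold_locales, simp_all add: of_rat_add of_rat_mult)
  also have "map_mat of_rat (mat n n (\<lambda>(i, j). a (Suc i) (Suc j)))
      = (mat n n (\<lambda>(i, j). of_rat (a (Suc i) (Suc j))) :: 'a mat)"
    by (intro eq_matI) auto
  finally show ?thesis by (simp only: det\<^sub>1_def)
qed

lemma det_binom_diff:
  "det\<^sub>1 n (\<lambda>i j. real_of_int (binom_diff (x + y + j) (int x + 2 * int j) (int i)))
    = (\<Prod>j = 1..n. real x - real y + 3 * real j) * closed_form n x (real y)"
proof -
  let ?a = "\<lambda>i j. real_of_int (binom_diff (x + y + j) (int x + 2 * int j) (int i))"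
  let ?b = "\<lambda>i j. (real x - real y + 3 * real j) * gamma_entry x (real y) i j"
  \<comment> \<open>Row \<open>i\<close> of the reduced matrix comes from \<open>i - 1\<close>
    applications of the operator, evaluated at row 1.\<close>
  define c where "c i k = real_of_int (row_coeff (i - 1) 1 k)" for i k
  have "det\<^sub>1 n ?b = det\<^sub>1 n ?a"
  proof (rule det\<^sub>1_unitriangular_rows)
    fix i j :: nat assume ij: "1 \<le> i" "i \<le> n" "1 \<le> j" "j \<le> n"
    have "?b i j = real_of_int (binom_diff (x + y + j + 2 * (i - 1)) (int x + 2 * int j + int (i - 1)) 1)"
      using ij by (intro reduced_entry[symmetric])
    also have "\<dots> = real_of_int (\<Sum>k = 1..n. row_coeff (i - 1) 1 k * binom_diff (x + y + j) (int x + 2 * int j) (int k))"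
      using binom_diff_row_coeff[of "i - 1" 1 n "x + y + j" "int x + 2 * int j"] ij by simp
    finally show "?b i j = (\<Sum>k = 1..n. c i k * ?a k j)" by (simp add: c_def)
  next
    fix i :: nat assume "1 \<le> i"
    thus "c i i = 1" using row_coeff_eq_1[of "i - 1" 0, where ?'a = int] by (simp add: c_def)
  next
    fix i k :: nat assume "1 \<le> i" "i < k"
    thus "c i k = 0" by (simp add: c_def row_coeff_eq_0)
  qed
  thus ?thesis by (simp add: det\<^sub>1_mult_columns det_gamma_entry)
qed

theorem theorem1:
  fixes n x y :: nat
  assumes "n \<ge> 1"
  shows "det\<^sub>1 n (\<lambda>i j.
             (of_nat (binom_int (x + y + j) (int x - int i + 2 * int j)) :: rat)
           - of_nat (binom_int (x + y + j) (int x + int i + 2 * int j)))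
       = (\<Prod>j = 1..n.
             fact (j - 1) * fact (x + y + 2 * j)
             * pochhammer (of_nat x - of_nat y + 2 * of_nat j + 1) j
             * pochhammer (of_nat x + 2 * of_nat y + 3 * of_nat j + 1) (n - j)
           / (fact (x + n + 2 * j) * fact (y + n - j)))"
    (is "?L = ?R")
proof -
  \<comment> \<open>The embedding of the rationals into the reals is injective, so it suffices to
    compare the real images.\<close>
  have "real_of_rat ?L = det\<^sub>1 n (\<lambda>i j. real_of_int (binom_diff (x + y + j) (int x + 2 * int j) (int i)))"
    by (simp add: of_rat_det\<^sub>1 of_rat_diff binom_diff_def algebra_simps)
  also have "\<dots> = real_of_rat ?R"
    unfolding det_binom_diff closed_form_nat
    by (simp add: of_rat_prod of_rat_divide of_rat_mult of_rat_fact of_rat_pochhammer of_rat_add of_rat_diff del: fact_Suc)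
  finally show ?thesis by simp
qed

end
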